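(* There is a polynomial-time algorithm that, given a graph $G$ with maximum degree $\Delta$, outputs a proper coloring of $G$ whose entropy is at most the minimum entropy of a proper coloring of $G$ plus $\log(\Delta+2) - 0.1423$ bits.
   Context: For an undirected graph $G=(V,E)$ with $n=|V|$, a proper coloring $\phi: V\to\mathbb{N}^+$ has entropy $-\sum_i p_i\log p_i$ where $p_i := |\phi^{-1}(i)|/n$ (logarithms base 2, $0\log 0:=0$). *)

theory Defs
  imports Complex_Main "HOL-Computational_Algebra.Polynomial"
begin

section \<open>Graphs and the entropy of a coloring\<close>

definition ugraph :: "'a set \<Rightarrow> 'a set set \<Rightarrow> bool" where
  "ugraph V E \<longleftrightarrow> finite V \<and> E \<subseteq> {{u, v} | u v. u \<in> V \<and> v \<in> V \<and> u \<noteq> v}"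

definition vdegree :: "'a set set \<Rightarrow> 'a \<Rightarrow> nat" where
  "vdegree E v = card {e \<in> E. v \<in> e}"

text \<open>The inserted \<open>0\<close> only matters for the graph without vertices.\<close>

definition max_degree :: "'a set \<Rightarrow> 'a set set \<Rightarrow> nat" where
  "max_degree V E = Max (insert 0 (vdegree E ` V))"

definition proper_coloring :: "'a set \<Rightarrow> 'a set set \<Rightarrow> ('a \<Rightarrow> nat) \<Rightarrow> bool" where
  "proper_coloring V E \<phi> \<longleftrightarrow>
     (\<forall>v\<in>V. \<phi> v > 0) \<and> (\<forall>u\<in>V. \<forall>v\<in>V. {u, v} \<in> E \<longrightarrow> \<phi> u \<noteq> \<phi> v)"

definition color_prob :: "'a set \<Rightarrow> ('a \<Rightarrow> nat) \<Rightarrow> nat \<Rightarrow> real" where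
  "color_prob V \<phi> i = real (card {v \<in> V. \<phi> v = i}) / real (card V)"

text \<open>Colors that are not used have probability \<open>0\<close>, so by the convention \<open>0 log 0 = 0\<close> the sum
  may be restricted to the finite set of colors in use.\<close>

definition coloring_entropy :: "'a set \<Rightarrow> ('a \<Rightarrow> nat) \<Rightarrow> real" where
  "coloring_entropy V \<phi> = - (\<Sum>i\<in>\<phi> ` V. color_prob V \<phi> i * log 2 (color_prob V \<phi> i))"

definition min_entropy :: "'a set \<Rightarrow> 'a set set \<Rightarrow> real" where
  "min_entropy V E = Inf {coloring_entropy V \<phi> | \<phi>. proper_coloring V E \<phi>}"

text \<open>The infimum is a minimum: the entropy only depends on the partition into color classes.\<close>

lemma coloring_entropy_partition:
  "coloring_entropy V \<phi> = - (\<Sum>A\<in>(\<lambda>i. {v \<in> V. \<phi> v = i}) ` \<phi> ` V.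
     real (card A) / real (card V) * log 2 (real (card A) / real (card V)))"
proof -
  have "inj_on (\<lambda>i. {v \<in> V. \<phi> v = i}) (\<phi> ` V)"
    by (rule inj_onI) auto
  then show ?thesis
    unfolding coloring_entropy_def color_prob_def by (simp add: sum.reindex)
qed

lemma min_entropy_attained:
  assumes "ugraph V E"
  shows "\<exists>\<phi>. proper_coloring V E \<phi> \<and> coloring_entropy V \<phi> = min_entropy V E"
proof -
  let ?S = "{coloring_entropy V \<phi> | \<phi>. proper_coloring V E \<phi>}"
  let ?h = "\<lambda>P. - (\<Sum>A\<in>P. real (card A) / real (card V) * log 2 (real (card A) / real (card V)))"
  have fin: "finite V" using assms by (simp add: ugraph_def)
  have "?S \<subseteq> ?h ` Pow (Pow V)"
    by (auto simp: coloring_entropy_partition intro!: imageI)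
  then have finS: "finite ?S"
    using fin by (meson finite_Pow_iff finite_imageI finite_subset)
  obtain f :: "'a \<Rightarrow> nat" where f: "inj_on f V"
    using fin finite_imp_inj_to_nat_seg by blast
  have "proper_coloring V E (\<lambda>v. Suc (f v))"
    unfolding proper_coloring_def
  proof (intro conjI ballI impI)
    fix u v assume "u \<in> V" "v \<in> V" "{u, v} \<in> E"
    moreover from this have "u \<noteq> v"
      using assms by (auto simp: ugraph_def doubleton_eq_iff)
    ultimately show "Suc (f u) \<noteq> Suc (f v)" using f by (auto dest: inj_onD)
  qed simp
  then have "?S \<noteq> {}" by blast
  with finS have "Inf ?S \<in> ?S"
    by (metis (no_types, lifting) Min_in cInf_eq_Min)
  then show ?thesis unfolding min_entropy_def by auto
qed

section \<open>Random access machines\<close>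

text \<open>
  Structured programs for a random access machine with registers and an indirectly addressed
  memory, both holding natural numbers; \<open>Sub\<close> truncates at \<open>0\<close>. Every instruction and every test
  costs one time unit. Since addition and subtraction are the only arithmetic, a run of \<open>t\<close> steps
  only produces numbers with \<open>O(t)\<close> more bits than those in the input and the program. Hence this
  unit-cost model is polynomially equivalent to Turing machines.
\<close>

datatype com =
    Skip
  | Const nat nat            (* R[d] := k *)
  | Add nat nat nat          (* R[d] := R[a] + R[b] *)
  | Sub nat nat nat          (* R[d] := R[a] - R[b] *)
  | Load nat nat             (* R[d] := M[R[a]] *)
  | Store nat nat            (* M[R[a]] := R[b] *)
  | Seq com com
  | IfNZ nat com com
  | WhileNZ nat com

type_synonym state = "(nat \<Rightarrow> nat) \<times> (nat \<Rightarrow> nat)"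

text \<open>\<open>exec c (R, M) t (R', M')\<close>: started with registers \<open>R\<close> and memory \<open>M\<close>, the program \<open>c\<close> halts
  after exactly \<open>t\<close> steps with registers \<open>R'\<close> and memory \<open>M'\<close>.\<close>

inductive exec :: "com \<Rightarrow> state \<Rightarrow> nat \<Rightarrow> state \<Rightarrow> bool" where
  Skip: "exec Skip (R, M) 1 (R, M)"
| Const: "exec (Const d k) (R, M) 1 (R(d := k), M)"
| Add: "exec (Add d a b) (R, M) 1 (R(d := R a + R b), M)"
| Sub: "exec (Sub d a b) (R, M) 1 (R(d := R a - R b), M)"
| Load: "exec (Load d a) (R, M) 1 (R(d := M (R a)), M)"
| Store: "exec (Store a b) (R, M) 1 (R, M(R a := R b))"
| Seq: "exec c1 s t1 s' \<Longrightarrow> exec c2 s' t2 s'' \<Longrightarrow> exec (Seq c1 c2) s (t1 + t2) s''"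
| IfTrue: "R r \<noteq> 0 \<Longrightarrow> exec c1 (R, M) t s' \<Longrightarrow> exec (IfNZ r c1 c2) (R, M) (t + 1) s'"
| IfFalse: "R r = 0 \<Longrightarrow> exec c2 (R, M) t s' \<Longrightarrow> exec (IfNZ r c1 c2) (R, M) (t + 1) s'"
| WhileFalse: "R r = 0 \<Longrightarrow> exec (WhileNZ r c) (R, M) 1 (R, M)"
| WhileTrue: "R r \<noteq> 0 \<Longrightarrow> exec c (R, M) t1 s' \<Longrightarrow> exec (WhileNZ r c) s' t2 s'' \<Longrightarrow>
    exec (WhileNZ r c) (R, M) (t1 + t2 + 1) s''"

inductive_cases SkipE: "exec Skip s t s'"
  and ConstE: "exec (Const d k) s t s'"
  and AddE: "exec (Add d a b) s t s'"
  and SubE: "exec (Sub d a b) s t s'"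
  and LoadE: "exec (Load d a) s t s'"
  and StoreE: "exec (Store a b) s t s'"
  and SeqE: "exec (Seq c1 c2) s t s'"
  and IfE: "exec (IfNZ r c1 c2) s t s'"
  and WhileE: "exec (WhileNZ r c) s t s'"

lemma exec_deterministic:
  "exec c s t s' \<Longrightarrow> exec c s u s'' \<Longrightarrow> u = t \<and> s'' = s'"
proof (induction arbitrary: u s'' rule: exec.induct)
  case (Seq c1 s t1 s' c2 t2 s2)
  from Seq.prems obtain v1 v2 r where "u = v1 + v2" "exec c1 s v1 r" "exec c2 r v2 s''"
    by (rule SeqE)
  with Seq.IH show ?case by metis
next
  case (IfTrue R r c1 M t s' c2)
  from IfTrue.prems IfTrue.hyps obtain v where "u = Suc v" "exec c1 (R, M) v s''"
    by (auto elim: IfE)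
  with IfTrue.IH show ?case by auto
next
  case (IfFalse R r c2 M t s' c1)
  from IfFalse.prems IfFalse.hyps obtain v where "u = Suc v" "exec c2 (R, M) v s''"
    by (auto elim: IfE)
  with IfFalse.IH show ?case by auto
next
  case (WhileFalse R r c M)
  from WhileFalse.prems WhileFalse.hyps show ?case by (auto elim: WhileE)
next
  case (WhileTrue R r c M t1 s' t2 s2)
  from WhileTrue.prems WhileTrue.hyps obtain v1 q v2
    where v: "u = Suc (v1 + v2)" "exec c (R, M) v1 q" "exec (WhileNZ r c) q v2 s''"
    by (auto elim: WhileE)
  from v(2) have "v1 = t1" "q = s'" using WhileTrue.IH(1) by blast+
  with v WhileTrue.IH(2) show ?case by auto
qed (erule SkipE ConstE AddE SubE LoadE StoreE; simp)+

section \<open>Polynomial-time graph algorithms\<close>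

text \<open>A graph on the vertices \<open>0, \<dots>, n - 1\<close> is given by \<open>n\<close> in register \<open>0\<close> and its adjacency matrix
  in the memory cells \<open>0, \<dots>, n * n - 1\<close>, row by row; everything else is \<open>0\<close>. The color of vertex
  \<open>v\<close> is read off memory cell \<open>v\<close> at termination.\<close>

definition graph_input :: "nat \<Rightarrow> nat set set \<Rightarrow> state" where
  "graph_input n E =
     ((\<lambda>r. if r = 0 then n else 0),
      (\<lambda>a. if a < n * n \<and> {a div n, a mod n} \<in> E then 1 else 0))"

definition polynomial_time :: "com \<Rightarrow> bool" where
  "polynomial_time A \<longleftrightarrow> (\<exists>p :: nat poly. \<forall>n E. ugraph {..<n} E \<longrightarrow>
     (\<exists>t s. exec A (graph_input n E) t s \<and> t \<le> poly p n))"

definition outputs :: "com \<Rightarrow> nat \<Rightarrow> nat set set \<Rightarrow> (nat \<Rightarrow> nat) \<Rightarrow> bool" where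
  "outputs A n E \<phi> \<longleftrightarrow> (\<exists>t R M. exec A (graph_input n E) t (R, M) \<and> (\<forall>v<n. \<phi> v = M v))"

end

theory Submission
  imports Defs
begin

text \<open>
  Greedy first-fit coloring suffices. A vertex gets color \<open>c\<close> only if it has at least \<open>c - 1\<close> lower
  neighbors, so at most \<open>\<Delta> + 1\<close> colors are used, and the sum of \<open>\<phi> v - 1\<close> over all vertices is at
  most the number of edges. If every color class of an optimal coloring has at most \<open>9n / 10\<close>
  vertices, the minimum entropy is at least \<open>log (10 / 9) \<ge> 1 / 7 > 0.1423\<close>, and the trivial bound
  \<open>log (\<Delta> + 1)\<close> is good enough. Otherwise there is an independent set of more than \<open>9n / 10\<close>
  vertices, hence there are at most \<open>n \<Delta> / 10\<close> edges. The mean of \<open>\<phi> - 1\<close> is then at most \<open>\<Delta> / 10\<close>,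
  which bounds the entropy by \<open>log (e (1 + \<Delta> / 10))\<close>; this is small enough for \<open>\<Delta> \<ge> 2\<close>. For
  \<open>\<Delta> \<le> 1\<close> the bound \<open>log (\<Delta> + 1)\<close> suffices again.
\<close>

section \<open>Entropy bounds\<close>

lemma sum_color_classes:
  assumes "finite V"
  shows "(\<Sum>i\<in>\<phi> ` V. color_prob V \<phi> i * f i) = (\<Sum>v\<in>V. f (\<phi> v)) / card V"
proof -
  have "(\<Sum>v\<in>V. f (\<phi> v)) = (\<Sum>i\<in>\<phi> ` V. \<Sum>v\<in>{v \<in> V. \<phi> v = i}. f (\<phi> v))"
    using assms by (rule sum.image_gen)
  also have "\<dots> = (\<Sum>i\<in>\<phi> ` V. card {v \<in> V. \<phi> v = i} * f i)"
    by (intro sum.cong) auto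
  finally show ?thesis
    by (simp add: color_prob_def sum_divide_distrib)
qed

lemma sum_color_prob:
  assumes "finite V" "V \<noteq> {}"
  shows "(\<Sum>i\<in>\<phi> ` V. color_prob V \<phi> i) = 1"
  using sum_color_classes[OF assms(1), of \<phi> "\<lambda>_. 1"] assms by simp

lemma color_prob_pos:
  assumes "finite V" "i \<in> \<phi> ` V"
  shows "color_prob V \<phi> i > 0"
proof -
  have "card {v \<in> V. \<phi> v = i} > 0" "card V > 0"
    using assms by (auto simp: card_gt_0_iff)
  then show ?thesis by (simp add: color_prob_def)
qed

text \<open>Gibbs' inequality: \<open>ln x <= x - 1\<close> at \<open>x = q i / p i\<close>,
  weighted by \<open>p i\<close> and summed. The cross entropy is averaged over vertices, so bounds
  on their colors or on the mean color apply directly.\<close>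

lemma coloring_entropy_le_cross_entropy:
  assumes "finite V" "V \<noteq> {}" and q: "\<And>i. i \<in> \<phi> ` V \<Longrightarrow> q i > 0" and "sum q (\<phi> ` V) \<le> 1"
  shows "coloring_entropy V \<phi> \<le> (\<Sum>v\<in>V. - log 2 (q (\<phi> v))) / card V"
proof -
  let ?p = "color_prob V \<phi>"
  have "(\<Sum>i\<in>\<phi> ` V. ?p i * log 2 (q i) - ?p i * log 2 (?p i)) \<le> (\<Sum>i\<in>\<phi> ` V. (q i - ?p i) / ln 2)"
  proof (rule sum_mono)
    fix i assume i: "i \<in> \<phi> ` V"
    have p: "?p i > 0" using assms(1) i by (rule color_prob_pos)
    have "ln (q i / ?p i) \<le> q i / ?p i - 1"
      using p q[OF i] by (intro ln_le_minus_one) simp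
    then have "?p i * ln (q i / ?p i) \<le> q i - ?p i"
      using p by (simp add: field_simps)
    then have "?p i * ln (q i / ?p i) / ln 2 \<le> (q i - ?p i) / ln 2"
      by (intro divide_right_mono) auto
    then show "?p i * log 2 (q i) - ?p i * log 2 (?p i) \<le> (q i - ?p i) / ln 2"
      using p q[OF i] by (simp add: log_def ln_div field_simps)
  qed
  also have "\<dots> \<le> 0"
    using assms by (simp add: sum_color_prob sum_subtractf divide_nonpos_pos flip: sum_divide_distrib)
  finally have "coloring_entropy V \<phi> \<le> (\<Sum>i\<in>\<phi> ` V. ?p i * - log 2 (q i))"
    by (simp add: coloring_entropy_def sum_subtractf sum_negf)
  then show ?thesis
    by (subst (asm) sum_color_classes[OF assms(1)])
qed

lemma coloring_entropy_le_log_colors: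
  assumes "finite V" "V \<noteq> {}" "\<phi> ` V \<subseteq> {1..k}"
  shows "coloring_entropy V \<phi> \<le> log 2 k"
proof -
  have k: "k > 0" using assms by auto
  have "card (\<phi> ` V) \<le> k"
    using card_mono[OF _ assms(3)] by simp
  then have "coloring_entropy V \<phi> \<le> (\<Sum>v\<in>V. - log 2 (1 / k)) / card V"
    using k by (intro coloring_entropy_le_cross_entropy assms) auto
  also have "\<dots> = log 2 k"
    using assms k by (simp add: log_divide)
  finally show ?thesis .
qed

text \<open>Among the distributions on the nonnegative integers with mean \<open>m\<close>, the geometric one
  maximizes the entropy; \<open>3\<close> stands for \<open>e\<close>.\<close>

lemma coloring_entropy_le_log_mean:
  fixes m :: real
  assumes "finite V" "V \<noteq> {}" and m: "m > 0"
    and mean: "(\<Sum>v\<in>V. real (\<phi> v - 1)) \<le> m * card V" and pos: "\<And>v. v \<in> V \<Longrightarrow> \<phi> v > 0"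
  shows "coloring_entropy V \<phi> \<le> log 2 (3 * (1 + m))"
proof -
  \<comment> \<open>With this ratio the geometric distribution \<open>q\<close>, shifted to start at
    1, gives \<open>i - 1\<close> the mean \<open>r / (1 - r) = m\<close>.\<close>
  define r where "r = m / (1 + m)"
  define q where "q i = (1 - r) * r ^ (i - 1)" for i :: nat
  have r: "0 < r" "r < 1" and r': "1 - r = 1 / (1 + m)"
    using m by (auto simp: r_def field_simps)
  have cV: "real (card V) > 0" using assms by (simp add: card_gt_0_iff)
  have "inj_on (\<lambda>i. i - 1) (\<phi> ` V)"
    using pos by (auto intro!: inj_onI) (metis Suc_pred)
  then have "sum q (\<phi> ` V) = (1 - r) * (\<Sum>i\<in>(\<lambda>i. i - 1) ` \<phi> ` V. r ^ i)"
    by (simp add: q_def sum_distrib_left sum.reindex)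
  also have "\<dots> \<le> (1 - r) * (\<Sum>i. r ^ i)"
    using r assms(1) by (intro mult_left_mono sum_le_suminf summable_geometric) auto
  also have "\<dots> = 1" using r by (simp add: suminf_geometric)
  finally have "coloring_entropy V \<phi> \<le> (\<Sum>v\<in>V. - log 2 (q (\<phi> v))) / card V"
    using assms(1,2) r by (intro coloring_entropy_le_cross_entropy) (auto simp: q_def)
  also have "(\<Sum>v\<in>V. - log 2 (q (\<phi> v))) = (\<Sum>v\<in>V. log 2 (1 + m) + real (\<phi> v - 1) * log 2 (1 / r))"
    using r m by (intro sum.cong)
      (auto simp: q_def log_mult log_nat_power log_divide r' )
  also have "\<dots> = card V * log 2 (1 + m) + (\<Sum>v\<in>V. real (\<phi> v - 1)) * log 2 (1 / r)"
    by (simp add: sum.distrib sum_distrib_right)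
  also have "\<dots> \<le> card V * log 2 (1 + m) + (m * card V) * log 2 (1 / r)"
    using mean r by (intro add_left_mono mult_right_mono) auto
  also have "\<dots> / card V = log 2 (1 + m) + m * log 2 (1 / r)"
    using cV by (simp add: field_simps)
  \<comment> \<open>As \<open>1 / r = 1 + 1 / m\<close>, the inequality
    \<open>ln (1 + x) <= x\<close> bounds the left side by \<open>log e\<close>.\<close>
  also have "m * log 2 (1 / r) \<le> log 2 3"
  proof -
    have "ln (1 / r) \<le> 1 / r - 1" using r by (intro ln_le_minus_one) auto
    also have "\<dots> = 1 / m" using m by (simp add: r_def field_simps)
    finally have "m * ln (1 / r) \<le> 1" using m by (simp add: field_simps)
    also have "1 \<le> ln (3 :: real)" using exp_le by (simp add: ln_ge_iff)
    finally show ?thesis by (simp add: log_def divide_right_mono)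
  qed
  finally show ?thesis
    using cV m by (subst log_mult) (simp_all add: divide_right_mono)
qed

text \<open>Entropy is the mean of \<open>- log p\<close>, each at least \<open>log c\<close>. Used
  with \<open>c = 10 / 9\<close>, and with \<open>c = 1\<close> for nonnegativity.\<close>

lemma coloring_entropy_ge_log_class:
  assumes "finite V" "V \<noteq> {}" "c > 0"
    and "\<And>i. i \<in> \<phi> ` V \<Longrightarrow> color_prob V \<phi> i \<le> 1 / c"
  shows "coloring_entropy V \<phi> \<ge> log 2 c"
proof -
  have "(\<Sum>i\<in>\<phi> ` V. color_prob V \<phi> i * log 2 (color_prob V \<phi> i))
      \<le> (\<Sum>i\<in>\<phi> ` V. color_prob V \<phi> i * - log 2 c)"
  proof (rule sum_mono)
    fix i assume i: "i \<in> \<phi> ` V"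
    have p: "color_prob V \<phi> i > 0" using assms(1) i by (rule color_prob_pos)
    have "log 2 (color_prob V \<phi> i) \<le> log 2 (1 / c)"
      using p assms(3) assms(4)[OF i] by simp
    then show "color_prob V \<phi> i * log 2 (color_prob V \<phi> i) \<le> color_prob V \<phi> i * - log 2 c"
      using p assms(3) by (intro mult_left_mono) (auto simp: log_divide)
  qed
  also have "\<dots> = - log 2 c"
    using sum_color_prob[OF assms(1,2), of \<phi>] by (simp add: sum_negf flip: sum_distrib_right)
  finally show ?thesis by (simp add: coloring_entropy_def)
qed

section \<open>First-fit colorings\<close>

definition lower_nbrs :: "nat set set \<Rightarrow> nat \<Rightarrow> nat set" where
  "lower_nbrs E v = {u. u < v \<and> {v, u} \<in> E}"

text \<open>The greedy choice as a local condition, without recursion, so that it can be asserted of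
  the memory of a running program.\<close>

definition first_fit_at :: "nat set set \<Rightarrow> (nat \<Rightarrow> nat) \<Rightarrow> nat \<Rightarrow> bool" where
  "first_fit_at E \<phi> v \<longleftrightarrow>
     \<phi> v > 0 \<and> \<phi> v \<notin> \<phi> ` lower_nbrs E v \<and> {1..<\<phi> v} \<subseteq> \<phi> ` lower_nbrs E v"

lemma finite_lower_nbrs [simp]: "finite (lower_nbrs E v)"
  by (simp add: lower_nbrs_def)

lemma first_fit_color_le:
  assumes "first_fit_at E \<phi> v"
  shows "\<phi> v - 1 \<le> card (lower_nbrs E v)"
proof -
  have "card {1..<\<phi> v} \<le> card (\<phi> ` lower_nbrs E v)"
    using assms by (intro card_mono) (auto simp: first_fit_at_def)
  also have "\<dots> \<le> card (lower_nbrs E v)" by (rule card_image_le) simp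
  finally show ?thesis by simp
qed

lemma proper_coloring_first_fit:
  assumes "ugraph {..<n} E" "\<And>v. v < n \<Longrightarrow> first_fit_at E \<phi> v"
  shows "proper_coloring {..<n} E \<phi>"
  unfolding proper_coloring_def
proof (intro conjI ballI impI)
  fix v assume "v \<in> {..<n}"
  then show "\<phi> v > 0" using assms(2) by (auto simp: first_fit_at_def)
next
  \<comment> \<open>The larger endpoint of an edge sees the smaller one as a lower neighbor.\<close>
  have *: "\<phi> u \<noteq> \<phi> v" if "u < v" "v < n" "{u, v} \<in> E" for u v
    proof -
    have "u \<in> lower_nbrs E v" using that by (simp add: lower_nbrs_def insert_commute)
    then show ?thesis using assms(2)[OF that(2)] by (metis first_fit_at_def imageI)
  qed
  fix u v assume uv: "u \<in> {..<n}" "v \<in> {..<n}" "{u, v} \<in> E"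
  then have "u \<noteq> v" using assms(1) by (auto simp: ugraph_def doubleton_eq_iff)
  then show "\<phi> u \<noteq> \<phi> v"
    using uv *[of u v] *[of v u] by (cases u v rule: linorder_cases) (auto simp: insert_commute)
qed

lemma finite_edges: "ugraph V E \<Longrightarrow> finite E"
  by (rule finite_subset[of _ "Pow V"]) (auto simp: ugraph_def)

lemma card_lower_nbrs_le:
  assumes "ugraph {..<n} E" "v < n"
  shows "card (lower_nbrs E v) \<le> max_degree {..<n} E"
proof -
  have "card (lower_nbrs E v) \<le> vdegree E v"
    unfolding vdegree_def using finite_edges[OF assms(1)]
    by (intro card_inj_on_le[where f = "\<lambda>u. {v, u}"])
      (auto simp: lower_nbrs_def inj_on_def doubleton_eq_iff)
  also have "\<dots> \<le> max_degree {..<n} E"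
    unfolding max_degree_def using assms(2) by (intro Max_ge) auto
  finally show ?thesis .
qed

text \<open>The left side counts every edge once, at its larger endpoint. Each edge has an endpoint
  outside \<open>I\<close>, so the stars of those vertices cover all edges.\<close>

lemma sum_card_lower_nbrs_le:
  assumes G: "ugraph {..<n} E" and I: "I \<subseteq> {..<n}"
    and indep: "\<And>u v. u \<in> I \<Longrightarrow> v \<in> I \<Longrightarrow> {u, v} \<notin> E"
  shows "(\<Sum>v<n. card (lower_nbrs E v)) \<le> (n - card I) * max_degree {..<n} E"
proof -
  have "(\<Sum>v<n. card (lower_nbrs E v)) = card (Sigma {..<n} (lower_nbrs E))" by simp
  also have "\<dots> \<le> card (\<Union>v\<in>{..<n} - I. {e \<in> E. v \<in> e})"
  proof (rule card_inj_on_le)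
    show "inj_on (\<lambda>(v, u). {v, u}) (Sigma {..<n} (lower_nbrs E))"
      by (auto simp: inj_on_def lower_nbrs_def doubleton_eq_iff)
    show "(\<lambda>(v, u). {v, u}) ` Sigma {..<n} (lower_nbrs E) \<subseteq> (\<Union>v\<in>{..<n} - I. {e \<in> E. v \<in> e})"
      using indep by (fastforce simp: lower_nbrs_def)
    show "finite (\<Union>v\<in>{..<n} - I. {e \<in> E. v \<in> e})" using finite_edges[OF G] by auto
  qed
  also have "\<dots> \<le> (\<Sum>v\<in>{..<n} - I. vdegree E v)"
    unfolding vdegree_def by (rule card_UN_le) simp
  also have "\<dots> \<le> (\<Sum>v\<in>{..<n} - I. max_degree {..<n} E)"
    unfolding max_degree_def by (intro sum_mono Max_ge) auto
  also have "\<dots> = (n - card I) * max_degree {..<n} E"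
    using I by (simp add: card_Diff_subset finite_subset)
  finally show ?thesis .
qed

section \<open>Comparison of first fit with the minimum entropy\<close>

lemma log_ten_ninths: "log 2 (10 / 9) \<ge> 0.1423"
proof -
  \<comment> \<open>\<open>10^7 = 10000000\<close> exceeds \<open>2 * 9^7 = 9565938\<close>; this
    gives the bound \<open>1 / 7\<close>.\<close>
  have "1 \<le> log 2 ((10 / 9 :: real) ^ 7)"
    by (subst le_log_iff) (auto simp: power_divide)
  then show ?thesis by (simp add: log_nat_power del: log_divide)
qed

lemma first_fit_entropy:
  assumes G: "ugraph {..<n} E" and ff: "\<And>v. v < n \<Longrightarrow> first_fit_at E \<phi> v"
  shows "coloring_entropy {..<n} \<phi>
           \<le> min_entropy {..<n} E + (log 2 (real (max_degree {..<n} E) + 2) - 0.1423)"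
proof -
  define D where "D = max_degree {..<n} E"
  obtain \<psi> where \<psi>: "proper_coloring {..<n} E \<psi>" "coloring_entropy {..<n} \<psi> = min_entropy {..<n} E"
    using min_entropy_attained[OF G] by blast
  show ?thesis
  proof (cases "n = 0")
    \<comment> \<open>Both entropies are empty sums and the maximum degree is 0, which leaves
      \<open>log 2 2 - 0.1423 > 0\<close>.\<close>
    case True
    then show ?thesis
      using \<psi>(2) by (simp add: coloring_entropy_def max_degree_def)
  next
    case False
    then have V: "finite {..<n}" "{..<n} \<noteq> {}" by auto
    have nonneg: "min_entropy {..<n} E \<ge> 0"
    proof -
      have "color_prob {..<n} \<psi> i \<le> 1 / 1" for i
        using card_mono[OF V(1), of "{v \<in> {..<n}. \<psi> v = i}"] False by (auto simp: color_prob_def)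
      then have "log 2 1 \<le> coloring_entropy {..<n} \<psi>"
        by (intro coloring_entropy_ge_log_class V) simp_all
      then show ?thesis using \<psi>(2) by simp
    qed
    have color: "\<phi> v - 1 \<le> card (lower_nbrs E v)" if "v < n" for v
      using ff[OF that] by (rule first_fit_color_le)
    have "\<phi> v \<in> {1..D + 1}" if "v < n" for v
      using color[OF that] card_lower_nbrs_le[OF G that] ff[OF that]
      by (auto simp: D_def first_fit_at_def)
    then have "\<phi> ` {..<n} \<subseteq> {1..D + 1}" by auto
    from coloring_entropy_le_log_colors[OF V this]
    have many: "coloring_entropy {..<n} \<phi> \<le> log 2 (real D + 1)" by (simp add: add.commute)
    consider "D \<le> 1" | "\<forall>i\<in>\<psi> ` {..<n}. color_prob {..<n} \<psi> i \<le> 9 / 10"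
      | i where "D \<ge> 2" "color_prob {..<n} \<psi> i > 9 / 10"
      by (metis linorder_not_le not_less_eq_eq numeral_2_eq_2 One_nat_def)
    then show ?thesis
    proof cases
      case 1
      then have "log 2 (real D + 1) + log 2 (10 / 9) = log 2 ((real D + 1) * (10 / 9))"
        by (subst log_mult) auto
      \<comment> \<open>Equivalent to \<open>D <= 8\<close>.\<close>
      also have "\<dots> \<le> log 2 (real D + 2)" using 1 by simp
      finally show ?thesis using many nonneg log_ten_ninths by (simp add: D_def del: log_divide)
    next
      case 2
      then have "log 2 (10 / 9) \<le> min_entropy {..<n} E"
        unfolding \<psi>(2)[symmetric] by (intro coloring_entropy_ge_log_class V) auto
      moreover have "log 2 (real D + 1) \<le> log 2 (real D + 2)" by simp
      ultimately show ?thesis using many log_ten_ninths unfolding D_def by linarith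
    next
      case 3
      define I where "I = {v \<in> {..<n}. \<psi> v = i}"
      have I: "9 / 10 * real n < card I"
        using 3 False by (simp add: color_prob_def I_def field_simps)
      have "card I \<le> n" using card_mono[OF V(1), of I] by (auto simp: I_def)
      have "(\<Sum>v<n. \<phi> v - 1) \<le> (\<Sum>v<n. card (lower_nbrs E v))"
        using color by (intro sum_mono) auto
      also have "\<dots> \<le> (n - card I) * D"
        unfolding D_def using \<psi>(1)
        by (intro sum_card_lower_nbrs_le[OF G]) (force simp: I_def proper_coloring_def)+
      finally have "(\<Sum>v<n. real (\<phi> v - 1)) \<le> real ((n - card I) * D)"
        by (metis of_nat_le_iff of_nat_sum)
      also have "\<dots> \<le> (real n / 10) * D"
        using I \<open>card I \<le> n\<close> unfolding of_nat_mult by (intro mult_right_mono) (auto simp: of_nat_diff)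
      finally have "(\<Sum>v\<in>{..<n}. real (\<phi> v - 1)) \<le> real D / 10 * card {..<n}"
        by (simp add: mult.commute)
      then have "coloring_entropy {..<n} \<phi> \<le> log 2 (3 * (1 + real D / 10))"
        using 3 ff by (intro coloring_entropy_le_log_mean V) (auto simp: first_fit_at_def)
      \<comment> \<open>Equivalent to \<open>D >= 2\<close>, with equality at \<open>D = 2\<close>;
        hence the threshold between the cases.\<close>
      also have "\<dots> \<le> log 2 ((real D + 2) / (10 / 9))" using 3 by simp
      also have "\<dots> = log 2 (real D + 2) - log 2 (10 / 9)" by (subst log_divide) auto
      finally show ?thesis using nonneg log_ten_ninths unfolding D_def by linarith
    qed
  qed
qed

section \<open>A first-fit program\<close>

definition wp :: "com \<Rightarrow> state \<Rightarrow> (nat \<Rightarrow> state \<Rightarrow> bool) \<Rightarrow> bool" where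
  "wp c s Q \<longleftrightarrow> (\<exists>t s'. exec c s t s' \<and> Q t s')"

lemma wp_mono: "wp c s Q \<Longrightarrow> (\<And>t s'. Q t s' \<Longrightarrow> Q' t s') \<Longrightarrow> wp c s Q'"
  unfolding wp_def by blast

inductive_simps exec_iff:
  "exec Skip (R, M) t s'" "exec (Const d k) (R, M) t s'" "exec (Add d a b) (R, M) t s'"
  "exec (Sub d a b) (R, M) t s'" "exec (Load d a) (R, M) t s'" "exec (Store a b) (R, M) t s'"
  "exec (IfNZ r c1 c2) (R, M) t s'"

lemma wp_basic [simp]:
  "wp Skip (R, M) Q \<longleftrightarrow> Q 1 (R, M)"
  "wp (Const d k) (R, M) Q \<longleftrightarrow> Q 1 (R(d := k), M)"
  "wp (Add d a b) (R, M) Q \<longleftrightarrow> Q 1 (R(d := R a + R b), M)"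
  "wp (Sub d a b) (R, M) Q \<longleftrightarrow> Q 1 (R(d := R a - R b), M)"
  "wp (Load d a) (R, M) Q \<longleftrightarrow> Q 1 (R(d := M (R a)), M)"
  "wp (Store a b) (R, M) Q \<longleftrightarrow> Q 1 (R, M(R a := R b))"
  by (simp_all add: wp_def exec_iff)

lemma wp_Seq [simp]:
  "wp (Seq c1 c2) s Q \<longleftrightarrow> wp c1 s (\<lambda>t s'. wp c2 s' (\<lambda>u. Q (t + u)))"
proof
  assume "wp (Seq c1 c2) s Q"
  then obtain t s'' where "exec (Seq c1 c2) s t s''" and Q: "Q t s''"
    unfolding wp_def by blast
  from this(1) show "wp c1 s (\<lambda>t s'. wp c2 s' (\<lambda>u. Q (t + u)))"
    by (rule SeqE) (use Q in \<open>auto simp only: wp_def\<close>)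
next
  assume "wp c1 s (\<lambda>t s'. wp c2 s' (\<lambda>u. Q (t + u)))"
  then obtain t s' u s'' where "exec c1 s t s'" "exec c2 s' u s''" "Q (t + u) s''"
    unfolding wp_def by blast
  then show "wp (Seq c1 c2) s Q"
    unfolding wp_def by (intro exI[of _ "t + u"] exI[of _ s'']) (simp add: exec.Seq)
qed

lemma wp_IfNZ [simp]:
  "wp (IfNZ r c1 c2) (R, M) Q \<longleftrightarrow> wp (if R r \<noteq> 0 then c1 else c2) (R, M) (\<lambda>t. Q (t + 1))"
  unfolding wp_def exec_iff by (cases "R r = 0") (simp_all, metis+)

text \<open>The variant \<open>f\<close> pays for the iterations: at most \<open>f s\<close> of
  them, each costing at most \<open>k\<close> and one test. The final \<open>+ 1\<close> is the
  failing test.\<close>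

lemma wp_while:
  assumes "I s"
    and step: "\<And>s. I s \<Longrightarrow> fst s r \<noteq> 0 \<Longrightarrow> wp c s (\<lambda>t s'. t \<le> k \<and> I s' \<and> f s' < (f s :: nat))"
  shows "wp (WhileNZ r c) s (\<lambda>t s'. t \<le> (k + 1) * f s + 1 \<and> I s' \<and> fst s' r = 0)"
  using assms(1)
proof (induction "f s" arbitrary: s rule: less_induct)
  case less
  obtain R M where s: "s = (R, M)" by fastforce
  show ?case
  proof (cases "R r = 0")
    case True
    then show ?thesis
      using less.prems unfolding wp_def s by (fastforce intro: WhileFalse)
  next
    case False
    then obtain t s' where t: "exec c s t s'" "t \<le> k" "I s'" "f s' < f s"
      using step[OF less.prems] by (auto simp: wp_def s)
    obtain u s'' where u: "exec (WhileNZ r c) s' u s''" "u \<le> (k + 1) * f s' + 1" "I s''" "fst s'' r = 0"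
      using less.hyps[OF t(4,3)] by (auto simp: wp_def)
    have "(k + 1) * (f s' + 1) \<le> (k + 1) * f s"
      using t(4) by (intro mult_le_mono) auto
    then have "t + u + 1 \<le> (k + 1) * f s + 1" using t(2) u(2) by (simp add: algebra_simps)
    then show ?thesis
      using u(3,4) WhileTrue[of R r c M t s' u s''] False t(1) u(1) unfolding wp_def s by blast
  qed
qed

section \<open>The program and its invariants\<close>

text \<open>Register 0 holds \<open>n\<close>, 1 holds \<open>1\<close>, 2 the current vertex \<open>v\<close>, 3 the address \<open>v * n\<close> of its row,
  4 the number of uncolored vertices, 5 the candidate color and 6 the vertex \<open>u\<close> it is compared
  with; register 9 stays \<open>0\<close>. Only the edges from \<open>v\<close> to lower vertices are read, hence no
  cell of row 0, which is free to hold the colors.\<close>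

definition ff_test :: com where
  "ff_test =
     Seq (Sub 6 6 1) (Seq (Add 7 3 6) (Seq (Load 7 7)
       (IfNZ 7
         (Seq (Load 7 6) (Seq (Sub 8 7 5) (Seq (Sub 7 5 7) (Seq (Add 7 7 8)
           (IfNZ 7 Skip (Seq (Add 5 5 1) (Add 6 2 9)))))))
         Skip)))"

text \<open>Adding register 9 copies a register. The machine cannot multiply, so the row address
  advances by \<open>n\<close> per vertex.\<close>

definition ff_vertex :: com where
  "ff_vertex =
     Seq (Const 5 1) (Seq (Add 6 2 9) (Seq (WhileNZ 6 ff_test)
       (Seq (Store 2 5) (Seq (Add 2 2 1) (Seq (Add 3 3 0) (Sub 4 4 1))))))"

definition ff_prog :: com where
  "ff_prog = Seq (Const 1 1) (Seq (Add 4 0 9) (WhileNZ 4 ff_vertex))"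

definition ff_inv :: "nat \<Rightarrow> nat set set \<Rightarrow> state \<Rightarrow> bool" where
  "ff_inv n E = (\<lambda>(R, M). R 0 = n \<and> R 1 = 1 \<and> R 2 \<le> n \<and> R 3 = R 2 * n \<and> R 4 = n - R 2 \<and> R 9 = 0 \<and>
     (\<forall>a\<ge>n. M a = snd (graph_input n E) a) \<and> (\<forall>w<R 2. first_fit_at E M w))"

text \<open>The scan descends from \<open>R 2\<close>, so the lower neighbors from
  \<open>R 6\<close> on have been compared with the candidate. The last conjunct is vacuous at
  \<open>R 6 = R 2\<close>; at \<open>R 6 = 0\<close> the candidate is the first-fit color.\<close>

definition ff_test_inv :: "nat \<Rightarrow> nat set set \<Rightarrow> state \<Rightarrow> bool" where
  "ff_test_inv n E = (\<lambda>(R, M). ff_inv n E (R, M) \<and> R 2 < n \<and> R 6 \<le> R 2 \<and> R 5 > 0 \<and>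
     {1..<R 5} \<subseteq> M ` lower_nbrs E (R 2) \<and> (\<forall>u\<in>lower_nbrs E (R 2). R 6 \<le> u \<longrightarrow> M u \<noteq> R 5))"

section \<open>Correctness and running time of the program\<close>

lemma adjacency_cell:
  assumes "u < v" "v < n"
  shows "v * n + u \<ge> n" "snd (graph_input n E) (v * n + u) = (if {v, u} \<in> E then 1 else 0)"
proof -
  \<comment> \<open>\<open>u < v\<close> forces \<open>v >= 1\<close>, so the cell lies outside row
    0, which the colors overwrite.\<close>
  have "1 * n \<le> v * n" using assms by (intro mult_le_mono1) simp
  then show "v * n + u \<ge> n" unfolding mult_1 by (rule trans_le_add1)
  have "Suc v * n \<le> n * n" using assms by (intro mult_le_mono) auto
  then have "v * n + u < n * n" using assms by simp
  moreover have "(v * n + u) div n = v" "(v * n + u) mod n = u" using assms by auto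
  ultimately show "snd (graph_input n E) (v * n + u) = (if {v, u} \<in> E then 1 else 0)"
    by (simp add: graph_input_def)
qed

text \<open>Each positive color below \<open>c\<close> needs its own lower neighbor. This keeps the
  truncated \<open>R 2 + 2 - R 5\<close> in \<open>ff_measure\<close> positive.\<close>

lemma colors_used_le:
  assumes "{1..<c} \<subseteq> (M :: nat \<Rightarrow> nat) ` lower_nbrs E v"
  shows "c \<le> v + 1"
proof -
  have "card {1..<c} \<le> card (M ` lower_nbrs E v)" using assms by (intro card_mono) auto
  also have "\<dots> \<le> card (lower_nbrs E v)" by (rule card_image_le) simp
  also have "\<dots> \<le> card {..<v}" by (rule card_mono) (auto simp: lower_nbrs_def)
  finally show ?thesis by simp
qed

definition ff_measure :: "nat \<Rightarrow> state \<Rightarrow> nat" where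
  "ff_measure n = (\<lambda>(R, M). (R 2 + 2 - R 5) * (n + 1) + R 6)"

text \<open>After a conflict the scan restarts at \<open>u = v\<close>, but with a larger color; the factor \<open>n + 1\<close>
  in \<open>ff_measure\<close> outweighs the increase of \<open>u\<close>.\<close>

lemma wp_ff_test:
  assumes "ff_test_inv n E (R, M)" "R 6 \<noteq> 0"
  shows "wp ff_test (R, M) (\<lambda>t s'. t \<le> 12 \<and>
    (ff_test_inv n E s' \<and> fst s' 2 = R 2 \<and> snd s' = M) \<and> ff_measure n s' < ff_measure n (R, M))"
proof -
  define v u c where "v = R 2" and "u = R 6 - 1" and "c = R 5"
  have inv: "v < n" "\<forall>a\<ge>n. M a = snd (graph_input n E) a" "\<forall>w<v. first_fit_at E M w"
    "R 4 = n - v" "c > 0" "{1..<c} \<subseteq> M ` lower_nbrs E v" "\<forall>w\<in>lower_nbrs E v. R 6 \<le> w \<longrightarrow> M w \<noteq> c"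
    and regs: "R 0 = n" "R 1 = 1" "R 2 = v" "R 3 = v * n" "R 9 = 0" "R 5 = c" "R 6 = Suc u"
    and u: "u < v"
    using assms by (auto simp: ff_test_inv_def ff_inv_def v_def u_def c_def)
  define conflict where "conflict \<longleftrightarrow> {v, u} \<in> E \<and> M u = c"
  have cell: "M (v * n + u) = (if {v, u} \<in> E then 1 else 0)"
    using inv(2) adjacency_cell[OF u inv(1)] by simp
  \<comment> \<open>The two truncated differences in \<open>ff_test\<close> add up to the distance
    between \<open>M u\<close> and \<open>c\<close>, so the sum vanishes exactly on equality. The
    longest path takes 11 steps.\<close>
  have "wp ff_test (R, M) (\<lambda>t s'. t \<le> 12 \<and> snd s' = M \<and>
      fst s' 5 = (if conflict then Suc c else c) \<and> fst s' 6 = (if conflict then v else u) \<and>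
      (\<forall>r\<in>{0, 1, 2, 3, 4, 9}. fst s' r = R r))"
    using cell regs by (simp add: ff_test_def conflict_def)
  then show ?thesis
  proof (rule wp_mono)
    fix t :: nat and s'
    assume run: "t \<le> 12 \<and> snd s' = M \<and>
      fst s' 5 = (if conflict then Suc c else c) \<and> fst s' 6 = (if conflict then v else u) \<and>
      (\<forall>r\<in>{0, 1, 2, 3, 4, 9}. fst s' r = R r)"
    obtain R' where s': "s' = (R', M)" using run by (cases s') auto
    have R': "R' 5 = (if conflict then Suc c else c)" "R' 6 = (if conflict then v else u)"
      "R' 0 = n" "R' 1 = 1" "R' 2 = v" "R' 3 = v * n" "R' 4 = n - v" "R' 9 = 0"
      using run regs inv(4) unfolding s' by auto
    have used: "{1..<R' 5} \<subseteq> M ` lower_nbrs E v"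
    proof
      fix a assume "a \<in> {1..<R' 5}"
      then have "a \<in> {1..<c} \<or> conflict \<and> a = c" using R'(1) by (auto split: if_splits)
      then show "a \<in> M ` lower_nbrs E v"
        using inv(6) u unfolding conflict_def lower_nbrs_def by blast
    qed
    \<comment> \<open>After a conflict no lower neighbor lies in the range from \<open>v\<close> on;
      otherwise only \<open>w = u\<close> is new, and it has just been compared.\<close>
    have free: "M w \<noteq> R' 5" if "w \<in> lower_nbrs E v" "R' 6 \<le> w" for w
    proof (cases "w = u")
      case True
      then show ?thesis using that R'(1,2) u by (auto simp: conflict_def lower_nbrs_def)
    next
      case False
      then show ?thesis
        using that R'(1,2) inv(7) regs(7) by (auto simp: lower_nbrs_def split: if_splits)
    qed
    have "ff_measure n s' < ff_measure n (R, M)"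
    proof (cases conflict)
      case True
      \<comment> \<open>Here \<open>used\<close> already includes \<open>c\<close>, so the raised
        candidate is at most \<open>v + 1\<close> and the subtraction is not truncated.\<close>
      then have "v + 2 - c = Suc (v + 2 - Suc c)"
        using colors_used_le[OF used] R'(1) by simp
      then show ?thesis
        using True R' regs inv(1) by (simp add: ff_measure_def s')
    next
      case False
      then show ?thesis using R' regs by (simp add: ff_measure_def s')
    qed
    moreover have "ff_test_inv n E s'"
      unfolding ff_test_inv_def ff_inv_def s'
      using R' used free inv u by (auto simp: lower_nbrs_def)
    ultimately show "t \<le> 12 \<and> (ff_test_inv n E s' \<and> fst s' 2 = R 2 \<and> snd s' = M) \<and>
        ff_measure n s' < ff_measure n (R, M)"
      using run by simp
  qed
qed

text \<open>First fit at \<open>v\<close> reads no cell above \<open>v\<close>, so coloring a later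
  vertex leaves it intact.\<close>

lemma first_fit_at_cong:
  "(\<And>u. u \<le> v \<Longrightarrow> M u = M' u) \<Longrightarrow> first_fit_at E M v \<longleftrightarrow> first_fit_at E M' v"
proof -
  assume "\<And>u. u \<le> v \<Longrightarrow> M u = M' u"
  then have "M v = M' v" "M ` lower_nbrs E v = M' ` lower_nbrs E v"
    by (auto simp: lower_nbrs_def intro!: image_cong)
  then show ?thesis by (simp add: first_fit_at_def)
qed

lemma wp_ff_vertex:
  assumes "ff_inv n E (R, M)" "R 4 \<noteq> 0"
  shows "wp ff_vertex (R, M) (\<lambda>t s'. t \<le> 13 * (n + 1) * (n + 2) + 7 \<and> ff_inv n E s' \<and> fst s' 4 < R 4)"
proof -
  define v where "v = R 2"
  define I where "I s \<longleftrightarrow> ff_test_inv n E s \<and> fst s 2 = v \<and> snd s = M" for s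
  define R0 where "R0 = R(5 := 1, 6 := v)"
  have inv: "v < n" "R 0 = n" "R 1 = 1" "R 2 = v" "R 3 = v * n" "R 4 = n - v" "R 9 = 0"
    "\<forall>a\<ge>n. M a = snd (graph_input n E) a" "\<forall>w<v. first_fit_at E M w"
    using assms by (auto simp: ff_inv_def v_def)
  have I0: "I (R0, M)"
    using inv by (auto simp: I_def R0_def ff_test_inv_def ff_inv_def lower_nbrs_def)
  have step: "wp ff_test s (\<lambda>t s'. t \<le> 12 \<and> I s' \<and> ff_measure n s' < ff_measure n s)"
    if "I s" "fst s 6 \<noteq> 0" for s
    using that wp_ff_test[of n E "fst s" "snd s"] unfolding prod.collapse by (simp add: I_def)
  \<comment> \<open>The scan starts with measure \<open>(v + 1) * (n + 1) + v\<close>; each unit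
    pays for 13 steps, 12 for the body and 1 for the test.\<close>
  have "v + 1 \<le> n" using inv(1) by simp
  then have "(v + 1) * (n + 1) \<le> n * (n + 1)" by (rule mult_le_mono1)
  then have "ff_measure n (R0, M) + 1 \<le> (n + 1) * (n + 2)"
    using inv by (simp add: ff_measure_def R0_def)
  then have time: "13 * ff_measure n (R0, M) + 13 \<le> 13 * (n + 1) * (n + 2)"
    unfolding mult.assoc by linarith
  have "wp (WhileNZ 6 ff_test) (R0, M)
      (\<lambda>t s'. t \<le> (12 + 1) * ff_measure n (R0, M) + 1 \<and> I s' \<and> fst s' 6 = 0)"
    by (rule wp_while) (use I0 step in auto)
  then have "wp (WhileNZ 6 ff_test) (R0, M)
      (\<lambda>t s. wp (Seq (Store 2 5) (Seq (Add 2 2 1) (Seq (Add 3 3 0) (Sub 4 4 1)))) s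
        (\<lambda>u s'. 2 + (t + u) \<le> 13 * (n + 1) * (n + 2) + 7 \<and> ff_inv n E s' \<and> fst s' 4 < R 4))"
  proof (rule wp_mono)
    fix t :: nat and s
    assume *: "t \<le> (12 + 1) * ff_measure n (R0, M) + 1 \<and> I s \<and> fst s 6 = 0"
    obtain R' where s: "s = (R', M)" using * by (cases s) (auto simp: I_def)
    \<comment> \<open>With register 6 at 0, all lower neighbors have been compared; the store at
      \<open>v\<close> changes none of their colors.\<close>
    have R': "R' 0 = n" "R' 1 = 1" "R' 2 = v" "R' 3 = v * n" "R' 4 = n - v" "R' 9 = 0"
      "first_fit_at E (M(v := R' 5)) v"
      using * unfolding s I_def
      by (auto simp: ff_test_inv_def ff_inv_def first_fit_at_def lower_nbrs_def)
    have "first_fit_at E (M(v := R' 5)) w" if "w < Suc v" for w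
    proof (cases "w = v")
      case False
      then show ?thesis
        using that inv(9) first_fit_at_cong[of w "M(v := R' 5)" M] by simp
    qed (use R' in simp)
    then show "wp (Seq (Store 2 5) (Seq (Add 2 2 1) (Seq (Add 3 3 0) (Sub 4 4 1)))) s
        (\<lambda>u s'. 2 + (t + u) \<le> 13 * (n + 1) * (n + 2) + 7 \<and> ff_inv n E s' \<and> fst s' 4 < R 4)"
      using R' inv time * unfolding s by (simp add: ff_inv_def)
  qed
  then show ?thesis
    using inv unfolding R0_def ff_vertex_def by (simp add: algebra_simps)
qed

text \<open>Register 4 is the variant, so there are at most \<open>n\<close> rounds; the 3 extra
  steps are the two initial instructions and the final test.\<close>

lemma wp_ff_prog:
  "wp ff_prog (graph_input n E) (\<lambda>t (R, M).
     t \<le> (13 * (n + 1) * (n + 2) + 8) * n + 3 \<and> (\<forall>v<n. first_fit_at E M v))"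
proof -
  define S M where "S = fst (graph_input n E)" and "M = snd (graph_input n E)"
  define R where "R = S(1 := 1, 4 := (S(1 := 1)) 0 + (S(1 := 1)) 9)"
  have R4: "R 4 = n" by (simp add: R_def S_def graph_input_def)
  have "ff_inv n E (R, M)"
    by (auto simp: ff_inv_def R_def S_def M_def graph_input_def)
  then have "wp (WhileNZ 4 ff_vertex) (R, M)
    (\<lambda>t s. t \<le> (13 * (n + 1) * (n + 2) + 7 + 1) * fst (R, M) 4 + 1 \<and> ff_inv n E s \<and> fst s 4 = 0)"
  proof (rule wp_while)
    fix s assume "ff_inv n E s" "fst s 4 \<noteq> 0"
    then show "wp ff_vertex s
        (\<lambda>t s'. t \<le> 13 * (n + 1) * (n + 2) + 7 \<and> ff_inv n E s' \<and> fst s' 4 < fst s 4)"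
      using wp_ff_vertex[of n E "fst s" "snd s"] unfolding prod.collapse by simp
  qed
  then have "wp (WhileNZ 4 ff_vertex) (R, M) (\<lambda>t (R, M).
      1 + (1 + t) \<le> (13 * (n + 1) * (n + 2) + 8) * n + 3 \<and> (\<forall>v<n. first_fit_at E M v))"
    by (rule wp_mono) (auto simp: ff_inv_def R4)
  moreover have "graph_input n E = (S, M)"
    by (simp add: S_def M_def)
  ultimately show ?thesis
    by (simp only: ff_prog_def wp_basic wp_Seq R_def)
qed

theorem theorem8:
  "\<exists>A. polynomial_time A \<and>
     (\<forall>n E. ugraph {..<n} E \<longrightarrow>
        (\<exists>\<phi>. outputs A n E \<phi> \<and> proper_coloring {..<n} E \<phi> \<and>
           coloring_entropy {..<n} \<phi>
             \<le> min_entropy {..<n} E + (log 2 (real (max_degree {..<n} E) + 2) - 0.1423)))"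
proof (intro exI[of _ ff_prog] conjI allI impI)
  show "polynomial_time ff_prog"
    unfolding polynomial_time_def
  \<comment> \<open>The factors \<open>[:1, 1:]\<close>, \<open>[:2, 1:]\<close> and
    \<open>[:0, 1:]\<close> stand for \<open>n + 1\<close>, \<open>n + 2\<close> and
    \<open>n\<close>.\<close>
  proof (intro exI[of _ "(([:13:] * [:1, 1:] * [:2, 1:] + [:8:]) * [:0, 1:] + [:3:])"] allI impI)
    fix n :: nat and E
    obtain t s where "exec ff_prog (graph_input n E) t s" "t \<le> (13 * (n + 1) * (n + 2) + 8) * n + 3"
      using wp_ff_prog[of n E] by (auto simp: wp_def)
    then show "\<exists>t s. exec ff_prog (graph_input n E) t s
        \<and> t \<le> poly (([:13:] * [:1, 1:] * [:2, 1:] + [:8:]) * [:0, 1:] + [:3:]) n"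
      by (intro exI[of _ t] exI[of _ s]) (simp add: algebra_simps)
  qed
  fix n :: nat and E assume G: "ugraph {..<n} E"
  obtain t R M where "exec ff_prog (graph_input n E) t (R, M)" and ff: "\<And>v. v < n \<Longrightarrow> first_fit_at E M v"
    using wp_ff_prog[of n E] by (auto simp: wp_def)
  then have "outputs ff_prog n E M" by (auto simp: outputs_def)
  then show "\<exists>\<phi>. outputs ff_prog n E \<phi> \<and> proper_coloring {..<n} E \<phi> \<and> coloring_entropy {..<n} \<phi>
      \<le> min_entropy {..<n} E + (log 2 (real (max_degree {..<n} E) + 2) - 0.1423)"
    using proper_coloring_first_fit[OF G ff] first_fit_entropy[OF G ff] by blast
qed

end
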